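(* Let $\mathcal{A},\mathcal{B}$ be two unital algebras over $\mathbb{C}$ with units $I_{\mathcal{A}}, I_{\mathcal{B}}$, let $m,n$ be two positive integers with $m\neq n$, and let $\mathcal{U}=\begin{bmatrix}\mathcal{A}&\mathcal{M}\\ \mathcal{N}&\mathcal{B}\end{bmatrix}$ be a generalized matrix algebra, where $\mathcal{M}$ is a unital $(\mathcal{A},\mathcal{B})$-bimodule and $\mathcal{N}$ is a unital $(\mathcal{B},\mathcal{A})$-bimodule. Suppose that one of the following four statements holds: (1) $\mathcal{M}$ is a faithful unital $(\mathcal{A},\mathcal{B})$-bimodule; (2) $\mathcal{N}$ is a faithful unital $(\mathcal{B},\mathcal{A})$-bimodule; (3) $\mathcal{M}$ is a faithful unital left $\mathcal{A}$-module and $\mathcal{N}$ is a faithful unital left $\mathcal{B}$-module; (4) $\mathcal{N}$ is a faithful unital right $\mathcal{A}$-module and $\mathcal{M}$ is a faithful unital right $\mathcal{B}$-module. Then every $(m,n)$-Jordan derivable mapping at zero $\delta:\mathcal{U}\to\mathcal{U}$ satisfying $\delta\left(\begin{bmatrix}I_{\mathcal{A}}&0\\0&I_{\mathcal{B}}\end{bmatrix}\right)=\begin{bmatrix}0&0\\0&0\end{bmatrix}$ is identically equal to zero.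
   Context: All algebras are over the complex field $\mathbb{C}$. A Morita context consists of algebras $\mathcal{A},\mathcal{B}$, an $(\mathcal{A},\mathcal{B})$-bimodule $\mathcal{M}$, a $(\mathcal{B},\mathcal{A})$-bimodule $\mathcal{N}$, and bimodule homomorphisms $\phi:\mathcal{M}\otimes_{\mathcal{B}}\mathcal{N}\to\mathcal{A}$ and $\varphi:\mathcal{N}\otimes_{\mathcal{A}}\mathcal{M}\to\mathcal{B}$ (written as products $MN:=\phi(M\otimes N)$, $NM:=\varphi(N\otimes M)$) satisfying the associativity conditions $(MN)M'=M(NM')$ and $(NM)N'=N(MN')$ for all $M,M'\in\mathcal{M}$, $N,N'\in\mathcal{N}$. The set $\mathcal{U}=\begin{bmatrix}\mathcal{A}&\mathcal{M}\\ \mathcal{N}&\mathcal{B}\end{bmatrix}$ of matrices $\begin{bmatrix}A&M\\N&B\end{bmatrix}$ with $A\in\mathcal{A}$, $B\in\mathcal{B}$, $M\in\mathcal{M}$, $N\in\mathcal{N}$ is then an algebra under the usual matrix addition and multiplication, called a generalized matrix algebra. A left $\mathcal{R}$-module $\mathcal{X}$ is (left) faithful if $R\mathcal{X}=\{0\}$ with $R\in\mathcal{R}$ implies $R=0$; a right $\mathcal{R}$-module $\mathcal{X}$ is (right) faithful if $\mathcal{X}R=\{0\}$ with $R\in\mathcal{R}$ implies $R=0$; a unital bimodule is faithful if it is both left faithful and right faithful over the respective algebras. For an algebra $\mathcal{U}$, a mapping $\delta:\mathcal{U}\to\mathcal{U}$ is an $(m,n)$-Jordan derivable mapping at zero if it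 is additive and $(m+n)\delta(ST+TS)=2m\delta(S)T+2m\delta(T)S+2nS\delta(T)+2nT\delta(S)$ for all $S,T\in\mathcal{U}$ with $ST=TS=0$. *)

theory Defs
  imports Complex_Main "HOL-Library.Poly_Mapping" "HOL-Library.Product_Plus"
begin

section \<open>Complex algebras and bimodules\<close>

locale complex_algebra = vector_space scale
  for scale :: "complex \<Rightarrow> 'u::ab_group_add \<Rightarrow> 'u" +
  fixes mult :: "'u \<Rightarrow> 'u \<Rightarrow> 'u"
  assumes mult_assoc: "mult (mult x y) z = mult x (mult y z)"
    and mult_add_left: "mult (x + y) z = mult x z + mult y z"
    and mult_add_right: "mult x (y + z) = mult x y + mult x z"
    and mult_scale_left: "mult (scale c x) y = scale c (mult x y)"
    and mult_scale_right: "mult x (scale c y) = scale c (mult x y)"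

text \<open>
  The unital coefficient algebras are types of sort \<open>{ring, monoid_mult}\<close> rather than
  \<open>ring_1\<close>, so that the zero algebra (where \<open>0 = 1\<close>) is not excluded.
\<close>

locale unital_bimodule =
  fixes scaleR :: "complex \<Rightarrow> 'r::{ring,monoid_mult} \<Rightarrow> 'r"
    and scaleS :: "complex \<Rightarrow> 's::{ring,monoid_mult} \<Rightarrow> 's"
    and scaleX :: "complex \<Rightarrow> 'x::ab_group_add \<Rightarrow> 'x"
    and lact :: "'r \<Rightarrow> 'x \<Rightarrow> 'x"
    and ract :: "'x \<Rightarrow> 's \<Rightarrow> 'x"
  assumes lact_linear_left: "Vector_Spaces.linear scaleR scaleX (\<lambda>r. lact r x)"
    and lact_linear_right: "Vector_Spaces.linear scaleX scaleX (lact r)"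
    and ract_linear_left: "Vector_Spaces.linear scaleX scaleX (\<lambda>x. ract x s)"
    and ract_linear_right: "Vector_Spaces.linear scaleS scaleX (ract x)"
    and lact_mult: "lact (r * r') x = lact r (lact r' x)"
    and ract_mult: "ract x (s * s') = ract (ract x s) s'"
    and lact_ract: "ract (lact r x) s = lact r (ract x s)"
    and lact_one: "lact 1 x = x"
    and ract_one: "ract x 1 = x"

definition left_faithful :: "('r::zero \<Rightarrow> 'x::zero \<Rightarrow> 'x) \<Rightarrow> bool" where
  "left_faithful lact \<longleftrightarrow> (\<forall>r. (\<forall>x. lact r x = 0) \<longrightarrow> r = 0)"

definition right_faithful :: "('x::zero \<Rightarrow> 'r::zero \<Rightarrow> 'x) \<Rightarrow> bool" where
  "right_faithful ract \<longleftrightarrow> (\<forall>r. (\<forall>x. ract x r = 0) \<longrightarrow> r = 0)"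


section \<open>Tensor products of bimodules\<close>

definition free_scale :: "complex \<Rightarrow> ('i \<Rightarrow>\<^sub>0 complex) \<Rightarrow> ('i \<Rightarrow>\<^sub>0 complex)" where
  "free_scale c = Poly_Mapping.map ((*) c)"

lemma lookup_free_scale [simp]: "Poly_Mapping.lookup (free_scale c u) i = c * Poly_Mapping.lookup u i"
  unfolding free_scale_def by (simp add: Poly_Mapping.map.rep_eq when_def)

interpretation free: vector_space free_scale
  by unfold_locales (auto intro!: poly_mapping_eqI simp: lookup_add algebra_simps)

text \<open>The linear extension of a map between the standard bases of two free spaces:\<close>

definition free_map :: "('i \<Rightarrow> 'j) \<Rightarrow> ('i \<Rightarrow>\<^sub>0 complex) \<Rightarrow> ('j \<Rightarrow>\<^sub>0 complex)" where
  "free_map f u = (\<Sum>i\<in>Poly_Mapping.keys u. Poly_Mapping.single (f i) (Poly_Mapping.lookup u i))"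

text \<open>
  \<open>X \<otimes>\<^sub>S Y\<close> is the free complex vector space on \<open>X \<times> Y\<close> modulo the span of the usual relators.
  Its elements are the residue classes, so it is a set of sets; the operations are the ones
  induced on residue classes.
\<close>

locale tensor_product =
  X: unital_bimodule scaleR scaleS scaleX lactX ractX +
  Y: unital_bimodule scaleS scaleT scaleY lactY ractY
  for scaleR :: "complex \<Rightarrow> 'r::{ring,monoid_mult} \<Rightarrow> 'r"
    and scaleS :: "complex \<Rightarrow> 's::{ring,monoid_mult} \<Rightarrow> 's"
    and scaleT :: "complex \<Rightarrow> 't::{ring,monoid_mult} \<Rightarrow> 't"
    and scaleX :: "complex \<Rightarrow> 'x::ab_group_add \<Rightarrow> 'x"
    and scaleY :: "complex \<Rightarrow> 'y::ab_group_add \<Rightarrow> 'y"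
    and lactX :: "'r \<Rightarrow> 'x \<Rightarrow> 'x"
    and ractX :: "'x \<Rightarrow> 's \<Rightarrow> 'x"
    and lactY :: "'s \<Rightarrow> 'y \<Rightarrow> 'y"
    and ractY :: "'y \<Rightarrow> 't \<Rightarrow> 'y"
begin

abbreviation basis :: "'x \<Rightarrow> 'y \<Rightarrow> ('x \<times> 'y \<Rightarrow>\<^sub>0 complex)" where
  "basis x y \<equiv> Poly_Mapping.single (x, y) 1"

definition relators :: "('x \<times> 'y \<Rightarrow>\<^sub>0 complex) set" where
  "relators =
     {basis (x + x') y - (basis x y + basis x' y) | x x' y. True} \<union>
     {basis x (y + y') - (basis x y + basis x y') | x y y'. True} \<union>
     {basis (scaleX c x) y - free_scale c (basis x y) | c x y. True} \<union>
     {basis x (scaleY c y) - free_scale c (basis x y) | c x y. True} \<union>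
     {basis (ractX x s) y - basis x (lactY s y) | x s y. True}"

definition tclass :: "('x \<times> 'y \<Rightarrow>\<^sub>0 complex) \<Rightarrow> ('x \<times> 'y \<Rightarrow>\<^sub>0 complex) set" where
  "tclass u = {v. v - u \<in> free.span relators}"

definition tcarrier :: "('x \<times> 'y \<Rightarrow>\<^sub>0 complex) set set" where
  "tcarrier = range tclass"

definition tensor :: "'x \<Rightarrow> 'y \<Rightarrow> ('x \<times> 'y \<Rightarrow>\<^sub>0 complex) set" where
  "tensor x y = tclass (basis x y)"

definition tadd where
  "tadd P Q = (\<Union>u\<in>P. \<Union>v\<in>Q. tclass (u + v))"

definition tscale where
  "tscale c P = (\<Union>u\<in>P. tclass (free_scale c u))"

definition tlact where
  "tlact r P = (\<Union>u\<in>P. tclass (free_map (\<lambda>(x, y). (lactX r x, y)) u))"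

definition tract where
  "tract P t = (\<Union>u\<in>P. tclass (free_map (\<lambda>(x, y). (x, ractY y t)) u))"

definition bimodule_hom ::
  "(complex \<Rightarrow> 'z::ab_group_add \<Rightarrow> 'z) \<Rightarrow> ('r \<Rightarrow> 'z \<Rightarrow> 'z) \<Rightarrow> ('z \<Rightarrow> 't \<Rightarrow> 'z)
     \<Rightarrow> (('x \<times> 'y \<Rightarrow>\<^sub>0 complex) set \<Rightarrow> 'z) \<Rightarrow> bool" where
  "bimodule_hom scaleZ lactZ ractZ h \<longleftrightarrow>
     (\<forall>P\<in>tcarrier. \<forall>Q\<in>tcarrier. h (tadd P Q) = h P + h Q) \<and>
     (\<forall>c. \<forall>P\<in>tcarrier. h (tscale c P) = scaleZ c (h P)) \<and>
     (\<forall>r. \<forall>P\<in>tcarrier. h (tlact r P) = lactZ r (h P)) \<and>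
     (\<forall>t. \<forall>P\<in>tcarrier. h (tract P t) = ractZ (h P) t)"

end


section \<open>Morita contexts and generalized matrix algebras\<close>

text \<open>The matrix with rows \<open>(A, M)\<close> and \<open>(N, B)\<close> is the pair of its rows.\<close>

type_synonym ('a, 'm, 'n, 'b) gen_matrix = "('a \<times> 'm) \<times> ('n \<times> 'b)"

locale Morita_context =
  A: complex_algebra scaleA "(*)" +
  B: complex_algebra scaleB "(*)" +
  M: unital_bimodule scaleA scaleB scaleM lM rM +
  N: unital_bimodule scaleB scaleA scaleN lN rN +
  MN: tensor_product scaleA scaleB scaleA scaleM scaleN lM rM lN rN +
  NM: tensor_product scaleB scaleA scaleB scaleN scaleM lN rN lM rM
  for scaleA :: "complex \<Rightarrow> 'a::{ring,monoid_mult} \<Rightarrow> 'a"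
    and scaleB :: "complex \<Rightarrow> 'b::{ring,monoid_mult} \<Rightarrow> 'b"
    and scaleM :: "complex \<Rightarrow> 'm::ab_group_add \<Rightarrow> 'm"
    and scaleN :: "complex \<Rightarrow> 'n::ab_group_add \<Rightarrow> 'n"
    and lM :: "'a \<Rightarrow> 'm \<Rightarrow> 'm"
    and rM :: "'m \<Rightarrow> 'b \<Rightarrow> 'm"
    and lN :: "'b \<Rightarrow> 'n \<Rightarrow> 'n"
    and rN :: "'n \<Rightarrow> 'a \<Rightarrow> 'n" +
  fixes \<phi> :: "('m \<times> 'n \<Rightarrow>\<^sub>0 complex) set \<Rightarrow> 'a"
    and \<psi> :: "('n \<times> 'm \<Rightarrow>\<^sub>0 complex) set \<Rightarrow> 'b"
  assumes \<phi>_hom: "MN.bimodule_hom scaleA (*) (*) \<phi>"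
    and \<psi>_hom: "NM.bimodule_hom scaleB (*) (*) \<psi>"
    and assoc_MNM: "lM (\<phi> (MN.tensor x y)) x' = rM x (\<psi> (NM.tensor y x'))"
    and assoc_NMN: "lN (\<psi> (NM.tensor y x)) y' = rN y (\<phi> (MN.tensor x y'))"
begin

definition gm_scale ::
  "complex \<Rightarrow> ('a, 'm, 'n, 'b) gen_matrix \<Rightarrow> ('a, 'm, 'n, 'b) gen_matrix" where
  "gm_scale c = (\<lambda>((A, M), (N, B)). ((scaleA c A, scaleM c M), (scaleN c N, scaleB c B)))"

definition gm_mult ::
  "('a, 'm, 'n, 'b) gen_matrix \<Rightarrow> ('a, 'm, 'n, 'b) gen_matrix \<Rightarrow> ('a, 'm, 'n, 'b) gen_matrix" where
  "gm_mult = (\<lambda>((A, M), (N, B)) ((A', M'), (N', B')).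
     ((A * A' + \<phi> (MN.tensor M N'), lM A M' + rM M B'),
      (rN N A' + lN B N', \<psi> (NM.tensor N M') + B * B')))"

end


section \<open>Jordan derivable mappings at zero\<close>

definition Jordan_derivable_at_zero ::
  "nat \<Rightarrow> nat \<Rightarrow> (complex \<Rightarrow> 'u::ab_group_add \<Rightarrow> 'u) \<Rightarrow> ('u \<Rightarrow> 'u \<Rightarrow> 'u) \<Rightarrow> ('u \<Rightarrow> 'u) \<Rightarrow> bool" where
  "Jordan_derivable_at_zero m n scale mult \<delta> \<longleftrightarrow>
     additive \<delta> \<and>
     (\<forall>S T. mult S T = 0 \<and> mult T S = 0 \<longrightarrow>
        scale (of_nat (m + n)) (\<delta> (mult S T + mult T S)) =
          scale (of_nat (2 * m)) (mult (\<delta> S) T) + scale (of_nat (2 * m)) (mult (\<delta> T) S) +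
          scale (of_nat (2 * n)) (mult S (\<delta> T)) + scale (of_nat (2 * n)) (mult T (\<delta> S)))"


section \<open>Well-definedness\<close>

lemma lookup_free_map:
  "Poly_Mapping.lookup (free_map f u) j =
     (\<Sum>i | i \<in> Poly_Mapping.keys u \<and> f i = j. Poly_Mapping.lookup u i)"
  unfolding free_map_def lookup_sum lookup_single when_def
  by (simp add: sum.If_cases Int_def)

lemma lookup_free_map':
  assumes "finite K" "Poly_Mapping.keys u \<subseteq> K"
  shows "Poly_Mapping.lookup (free_map f u) j = (\<Sum>i\<in>K. if f i = j then Poly_Mapping.lookup u i else 0)"
proof -
  have "(\<Sum>i\<in>K. if f i = j then Poly_Mapping.lookup u i else 0) =
      (\<Sum>i\<in>Poly_Mapping.keys u. if f i = j then Poly_Mapping.lookup u i else 0)"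
    using assms by (intro sum.mono_neutral_right) (auto simp: in_keys_iff)
  then show ?thesis
    unfolding lookup_free_map by (simp add: sum.If_cases Int_def)
qed

lemma linear_free_map: "Vector_Spaces.linear free_scale free_scale (free_map f)"
proof unfold_locales
  fix u v :: "'a \<Rightarrow>\<^sub>0 complex" and c
  let ?K = "Poly_Mapping.keys u \<union> Poly_Mapping.keys v"
  have L: "Poly_Mapping.lookup (free_map f w) j =
      (\<Sum>i\<in>?K. if f i = j then Poly_Mapping.lookup w i else 0)"
    if "Poly_Mapping.keys w \<subseteq> ?K" for w j
    using that by (intro lookup_free_map') auto
  have k: "Poly_Mapping.keys (u + v) \<subseteq> ?K" "Poly_Mapping.keys u \<subseteq> ?K"
    "Poly_Mapping.keys v \<subseteq> ?K" "Poly_Mapping.keys (free_scale c u) \<subseteq> ?K"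
    using Poly_Mapping.keys_add[of u v] by (auto simp: in_keys_iff)
  show "free_map f (u + v) = free_map f u + free_map f v"
    by (rule poly_mapping_eqI, unfold lookup_add L[OF k(1)] L[OF k(2)] L[OF k(3)] sum.distrib[symmetric])
       (intro sum.cong, auto)
  show "free_map f (free_scale c u) = free_scale c (free_map f u)"
    by (rule poly_mapping_eqI, unfold lookup_free_scale L[OF k(4)] L[OF k(2)] sum_distrib_left)
       (intro sum.cong, auto)
qed

lemma free_map_single [simp]: "free_map f (Poly_Mapping.single i c) = Poly_Mapping.single (f i) c"
  unfolding free_map_def by (cases "c = 0") auto

context tensor_product
begin

lemma tclass_eq_iff: "tclass u = tclass v \<longleftrightarrow> u - v \<in> free.span relators"
proof
  have "u \<in> tclass u" by (simp add: tclass_def free.span_zero)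
  moreover assume "tclass u = tclass v"
  ultimately have "u \<in> tclass v" by simp
  then show "u - v \<in> free.span relators" by (simp add: tclass_def)
next
  assume *: "u - v \<in> free.span relators"
  have "w - u \<in> free.span relators \<longleftrightarrow> w - v \<in> free.span relators" for w
  proof
    assume "w - u \<in> free.span relators"
    from free.span_add[OF this *] show "w - v \<in> free.span relators" by simp
  next
    assume "w - v \<in> free.span relators"
    from free.span_diff[OF this *] show "w - u \<in> free.span relators" by simp
  qed
  then show "tclass u = tclass v" by (simp add: tclass_def)
qed

lemma UN_tclass:
  assumes "\<And>v. v - u \<in> free.span relators \<Longrightarrow> F v = F u"
  shows "(\<Union>v\<in>tclass u. F v) = F u"
proof -
  have "u \<in> tclass u" by (simp add: tclass_def free.span_zero)
  moreover have "F v = F u" if "v \<in> tclass u" for v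
    using assms that by (simp add: tclass_def)
  ultimately show ?thesis by blast
qed

lemma tadd_tclass [simp]: "tadd (tclass u) (tclass v) = tclass (u + v)"
proof -
  have "(\<Union>v'\<in>tclass v. tclass (u' + v')) = tclass (u' + v)" for u'
    by (rule UN_tclass) (simp add: tclass_eq_iff)
  moreover have "(\<Union>u'\<in>tclass u. tclass (u' + v)) = tclass (u + v)"
    by (rule UN_tclass) (simp add: tclass_eq_iff)
  ultimately show ?thesis
    unfolding tadd_def by simp
qed

lemma tscale_tclass [simp]: "tscale c (tclass u) = tclass (free_scale c u)"
  unfolding tscale_def
  by (rule UN_tclass, unfold tclass_eq_iff free.scale_right_diff_distrib[symmetric])
     (rule free.span_scale)

lemma relatorsI:
  "basis (x + x') y - (basis x y + basis x' y) \<in> relators"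
  "basis x (y + y') - (basis x y + basis x y') \<in> relators"
  "basis (scaleX c x) y - free_scale c (basis x y) \<in> relators"
  "basis x (scaleY c y) - free_scale c (basis x y) \<in> relators"
  "basis (ractX x s) y - basis x (lactY s y) \<in> relators"
  unfolding relators_def by blast+

lemma relatorsE:
  assumes "w \<in> relators"
  obtains (addX) x x' y where "w = basis (x + x') y - (basis x y + basis x' y)"
    | (addY) x y y' where "w = basis x (y + y') - (basis x y + basis x y')"
    | (scaleX) c x y where "w = basis (scaleX c x) y - free_scale c (basis x y)"
    | (scaleY) c x y where "w = basis x (scaleY c y) - free_scale c (basis x y)"
    | (bal) x s y where "w = basis (ractX x s) y - basis x (lactY s y)"
  using assms unfolding relators_def by blast

lemma free_map_span_relators:
  assumes "\<And>w. w \<in> relators \<Longrightarrow> free_map f w \<in> relators"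
    and "w \<in> free.span relators"
  shows "free_map f w \<in> free.span relators"
proof -
  interpret f: Vector_Spaces.linear free_scale free_scale "free_map f" by (rule linear_free_map)
  have "free_map f w \<in> free.span (free_map f ` relators)"
    using assms(2) by (simp add: f.span_image)
  also have "\<dots> \<subseteq> free.span relators"
    using assms(1) by (intro free.span_mono) auto
  finally show ?thesis .
qed

lemma free_map_lact_relators:
  assumes "w \<in> relators"
  shows "free_map (\<lambda>(x, y). (lactX r x, y)) w \<in> relators"
proof -
  interpret f: Vector_Spaces.linear free_scale free_scale "free_map (\<lambda>(x, y). (lactX r x, y :: 'y))"
    by (rule linear_free_map)
  interpret l: Vector_Spaces.linear scaleX scaleX "lactX r" by (rule X.lact_linear_right)
  show ?thesis
    using assms
    by (cases rule: relatorsE)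
       (simp_all add: f.diff f.add f.scale l.add l.scale X.lact_ract[symmetric] relatorsI)
qed

lemma free_map_ract_relators:
  assumes "w \<in> relators"
  shows "free_map (\<lambda>(x, y). (x, ractY y t)) w \<in> relators"
proof -
  interpret f: Vector_Spaces.linear free_scale free_scale "free_map (\<lambda>(x :: 'x, y). (x, ractY y t))"
    by (rule linear_free_map)
  interpret l: Vector_Spaces.linear scaleY scaleY "\<lambda>y. ractY y t" by (rule Y.ract_linear_left)
  show ?thesis
    using assms
    by (cases rule: relatorsE)
       (simp_all add: f.diff f.add f.scale l.add l.scale Y.lact_ract relatorsI)
qed

lemma tlact_tclass [simp]:
  "tlact r (tclass u) = tclass (free_map (\<lambda>(x, y). (lactX r x, y)) u)"
proof -
  interpret f: Vector_Spaces.linear free_scale free_scale "free_map (\<lambda>(x, y). (lactX r x, y :: 'y))"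
    by (rule linear_free_map)
  show ?thesis
    unfolding tlact_def
    by (rule UN_tclass, unfold tclass_eq_iff f.diff[symmetric])
       (intro free_map_span_relators free_map_lact_relators)
qed

lemma tract_tclass [simp]:
  "tract (tclass u) t = tclass (free_map (\<lambda>(x, y). (x, ractY y t)) u)"
proof -
  interpret f: Vector_Spaces.linear free_scale free_scale "free_map (\<lambda>(x :: 'x, y). (x, ractY y t))"
    by (rule linear_free_map)
  show ?thesis
    unfolding tract_def
    by (rule UN_tclass, unfold tclass_eq_iff f.diff[symmetric])
       (intro free_map_span_relators free_map_ract_relators)
qed

lemma tclass_in_tcarrier [simp]: "tclass u \<in> tcarrier"
  by (simp add: tcarrier_def)

lemma tensor_in_tcarrier [simp]: "tensor x y \<in> tcarrier"
  by (simp add: tensor_def)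

lemma tensor_add_left: "tensor (x + x') y = tadd (tensor x y) (tensor x' y)"
  unfolding tensor_def tadd_tclass tclass_eq_iff
  by (intro free.span_base relatorsI)

lemma tensor_add_right: "tensor x (y + y') = tadd (tensor x y) (tensor x y')"
  unfolding tensor_def tadd_tclass tclass_eq_iff
  by (intro free.span_base relatorsI)

lemma tensor_scale_left: "tensor (scaleX c x) y = tscale c (tensor x y)"
  unfolding tensor_def tscale_tclass tclass_eq_iff
  by (intro free.span_base relatorsI)

lemma tensor_scale_right: "tensor x (scaleY c y) = tscale c (tensor x y)"
  unfolding tensor_def tscale_tclass tclass_eq_iff
  by (intro free.span_base relatorsI)

lemma tensor_balanced: "tensor (ractX x s) y = tensor x (lactY s y)"
  unfolding tensor_def tclass_eq_iff
  by (intro free.span_base relatorsI)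

lemma tensor_lact: "tensor (lactX r x) y = tlact r (tensor x y)"
  by (simp add: tensor_def)

lemma tensor_ract: "tensor x (ractY y t) = tract (tensor x y) t"
  by (simp add: tensor_def)

lemma bimodule_hom_tensor:
  assumes "bimodule_hom scaleZ lactZ ractZ h"
  shows "h (tensor (x + x') y) = h (tensor x y) + h (tensor x' y)"
    and "h (tensor x (y + y')) = h (tensor x y) + h (tensor x y')"
    and "h (tensor (scaleX c x) y) = scaleZ c (h (tensor x y))"
    and "h (tensor x (scaleY c y)) = scaleZ c (h (tensor x y))"
    and "h (tensor (lactX r x) y) = lactZ r (h (tensor x y))"
    and "h (tensor x (ractY y t)) = ractZ (h (tensor x y)) t"
  using assms
  by (simp_all add: bimodule_hom_def tensor_add_left tensor_add_right tensor_scale_left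
      tensor_scale_right tensor_lact tensor_ract)

end

context unital_bimodule
begin

lemma act_simps:
  "lact (r + r') x = lact r x + lact r' x" "lact r (x + x') = lact r x + lact r x'"
  "lact (scaleR c r) x = scaleX c (lact r x)" "lact r (scaleX c x) = scaleX c (lact r x)"
  "ract x (s + s') = ract x s + ract x s'" "ract (x + x') s = ract x s + ract x' s"
  "ract x (scaleS c s) = scaleX c (ract x s)" "ract (scaleX c x) s = scaleX c (ract x s)"
  using lact_linear_left lact_linear_right ract_linear_left ract_linear_right
  by (simp_all add: Vector_Spaces.linear_def module_hom_def module_hom_axioms_def)

lemma vector_space_scaleX: "vector_space scaleX"
  using lact_linear_right by (simp add: Vector_Spaces.linear_def)

end

context Morita_context
begin

lemma mult_simps:
  "\<phi> (MN.tensor (x + x') y) = \<phi> (MN.tensor x y) + \<phi> (MN.tensor x' y)"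
  "\<phi> (MN.tensor x (y + y')) = \<phi> (MN.tensor x y) + \<phi> (MN.tensor x y')"
  "\<phi> (MN.tensor (scaleM c x) y) = scaleA c (\<phi> (MN.tensor x y))"
  "\<phi> (MN.tensor x (scaleN c y)) = scaleA c (\<phi> (MN.tensor x y))"
  "\<phi> (MN.tensor (lM a x) y) = a * \<phi> (MN.tensor x y)"
  "\<phi> (MN.tensor x (rN y a)) = \<phi> (MN.tensor x y) * a"
  "\<psi> (NM.tensor (y + y') x) = \<psi> (NM.tensor y x) + \<psi> (NM.tensor y' x)"
  "\<psi> (NM.tensor y (x + x')) = \<psi> (NM.tensor y x) + \<psi> (NM.tensor y x')"
  "\<psi> (NM.tensor (scaleN c y) x) = scaleB c (\<psi> (NM.tensor y x))"
  "\<psi> (NM.tensor y (scaleM c x)) = scaleB c (\<psi> (NM.tensor y x))"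
  "\<psi> (NM.tensor (lN b y) x) = b * \<psi> (NM.tensor y x)"
  "\<psi> (NM.tensor y (rM x b)) = \<psi> (NM.tensor y x) * b"
  by (rule MN.bimodule_hom_tensor[OF \<phi>_hom] NM.bimodule_hom_tensor[OF \<psi>_hom])+

lemma gen_matrix_algebra: "complex_algebra gm_scale gm_mult"
proof -
  interpret MV: vector_space scaleM by (rule M.vector_space_scaleX)
  interpret NV: vector_space scaleN by (rule N.vector_space_scaleX)
  note scales = A.scale_right_distrib B.scale_right_distrib MV.scale_right_distrib
    NV.scale_right_distrib A.scale_left_distrib B.scale_left_distrib MV.scale_left_distrib
    NV.scale_left_distrib
  show ?thesis
  proof
    fix c d :: complex and X Y Z :: "('a, 'm, 'n, 'b) gen_matrix"
    obtain a1 m1 n1 b1 a2 m2 n2 b2 a3 m3 n3 b3 where XYZ: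
      "X = ((a1, m1), (n1, b1))" "Y = ((a2, m2), (n2, b2))" "Z = ((a3, m3), (n3, b3))"
      by (metis surj_pair)
    show "gm_scale c (X + Y) = gm_scale c X + gm_scale c Y"
      and "gm_scale (c + d) X = gm_scale c X + gm_scale d X"
      and "gm_scale c (gm_scale d X) = gm_scale (c * d) X"
      and "gm_scale 1 X = X"
      by (simp_all add: XYZ gm_scale_def scales)
    show "gm_mult (gm_mult X Y) Z = gm_mult X (gm_mult Y Z)"
      by (simp add: XYZ gm_mult_def mult_simps M.act_simps(1,2,5,6) N.act_simps(1,2,5,6)
          M.lact_mult N.lact_mult M.ract_mult N.ract_mult M.lact_ract N.lact_ract
          assoc_MNM assoc_NMN MN.tensor_balanced NM.tensor_balanced
          distrib_left distrib_right mult.assoc add_ac)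
    show "gm_mult (X + Y) Z = gm_mult X Z + gm_mult Y Z"
      and "gm_mult X (Y + Z) = gm_mult X Y + gm_mult X Z"
      by (simp_all add: XYZ gm_mult_def mult_simps M.act_simps(1,2,5,6) N.act_simps(1,2,5,6)
          distrib_left distrib_right add_ac)
    show "gm_mult (gm_scale c X) Y = gm_scale c (gm_mult X Y)"
      and "gm_mult X (gm_scale c Y) = gm_scale c (gm_mult X Y)"
      by (simp_all add: XYZ gm_mult_def gm_scale_def mult_simps(3,4,9,10)
          M.act_simps(3,4,7,8) N.act_simps(3,4,7,8) A.mult_scale_left A.mult_scale_right
          B.mult_scale_left B.mult_scale_right scales)
  qed
qed

lemma gm_mult_unit: "gm_mult ((1, 0), (0, 1)) X = X" "gm_mult X ((1, 0), (0, 1)) = X"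
proof -
  have "\<phi> (MN.tensor 0 y) = 0" "\<phi> (MN.tensor x 0) = 0"
    "\<psi> (NM.tensor 0 x) = 0" "\<psi> (NM.tensor y 0) = 0" for x y
    using mult_simps(1)[of 0 0 y] mult_simps(2)[of x 0 0] mult_simps(7)[of 0 0 x]
      mult_simps(8)[of y 0 0]
    by simp_all
  moreover have "lM a 0 = 0" "lM 0 x = 0" "rM 0 b = 0" "rM x 0 = 0"
    "lN b 0 = 0" "lN 0 y = 0" "rN 0 a = 0" "rN y 0 = 0" for a b x y
    using M.act_simps(1)[of 0 0 x] M.act_simps(2)[of a 0 0] M.act_simps(5)[of x 0 0]
      M.act_simps(6)[of 0 0 b] N.act_simps(1)[of 0 0 y] N.act_simps(2)[of b 0 0]
      N.act_simps(5)[of y 0 0] N.act_simps(6)[of 0 0 a]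
    by simp_all
  moreover obtain a x y b where "X = ((a, x), (y, b))"
    by (metis surj_pair)
  ultimately show "gm_mult ((1, 0), (0, 1)) X = X" "gm_mult X ((1, 0), (0, 1)) = X"
    by (simp_all add: gm_mult_def M.lact_one M.ract_one N.lact_one N.ract_one)
qed

end

end

theory Submission
  imports Defs
begin

text \<open>
  Since \<open>ST = TS = 0\<close> makes the left-hand side of the defining identity vanish, \<open>\<delta>\<close> satisfies
  \<open>m\<delta>(S)T + m\<delta>(T)S + nS\<delta>(T) + nT\<delta>(S) = 0\<close> for all such pairs.  Everything follows from
  applying this to an idempotent and an element that it annihilates on both sides.

  For an idempotent \<open>p\<close> the pair \<open>(p, 1 - p)\<close> is admissible, and \<open>\<delta>(1) = 0\<close> gives
  \<open>\<delta>(1 - p) = -\<delta>(p)\<close>; the identity becomes \<open>(m + n)\<delta>(p) = 2m\<delta>(p)p + 2np\<delta>(p)\<close>.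
  Comparing the two sides in each Peirce component with respect to \<open>p\<close>, one finds that
  component of \<open>\<delta>(p)\<close> multiplied by \<open>\<plusminus>(m + n)\<close> or \<open>\<plusminus>(m - n)\<close> to be zero, so \<open>\<delta>(p) = 0\<close>
  (\<open>idempotent_zero\<close>).  As \<open>p + x\<close> is idempotent for every off-diagonal Peirce element \<open>x\<close> of \<open>p\<close>, additivity gives \<open>\<delta>(x) = 0\<close>
  (\<open>off_diagonal_zero\<close>).

  If an idempotent \<open>t\<close> satisfies \<open>st = ts = 0\<close>, then, \<open>\<delta>(t)\<close> being zero, the identity reads
  \<open>m\<delta>(s)t + nt\<delta>(s) = 0\<close> and forces \<open>\<delta>(s)t = t\<delta>(s) = 0\<close> (\<open>annihilator_invariant\<close>).  With
  \<open>t = 1 - p\<close> this shows that \<open>\<delta>\<close> preserves the diagonal corner of \<open>p\<close>.  With the perturbed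
  idempotent \<open>t = 1 - p - x\<close>, where \<open>px = x\<close> and \<open>xp = 0\<close>, and \<open>s = a + ax\<close>, where \<open>a\<close> lies in
  the corner, it yields \<open>\<delta>(a)x = 0\<close> (\<open>corner_times_off_diagonal\<close>); passing to the opposite
  algebra, which exchanges \<open>m\<close> and \<open>n\<close>, yields the mirror image.

  In a generalized matrix algebra this says that \<open>\<delta>\<close> vanishes on \<open>\<M>\<close> and \<open>\<N>\<close>, maps
  \<open>\<A>\<close> into the elements of \<open>\<A>\<close> that annihilate \<open>\<M>\<close> from the left and \<open>\<N>\<close> from
  the right, and maps \<open>\<B>\<close> into those of \<open>\<B>\<close> that annihilate \<open>\<N>\<close> from the left and
  \<open>\<M>\<close> from the right.  Each of the four faithfulness hypotheses makes both annihilators zero.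
\<close>

section \<open>Jordan derivable mappings at zero on a unital algebra\<close>

context complex_algebra
begin

lemma mult_zero: "mult 0 x = 0" "mult x 0 = 0"
  using mult_add_left[of 0 0 x] mult_add_right[of x 0 0] by simp_all

lemma mult_minus: "mult (- x) y = - mult x y" "mult x (- y) = - mult x y"
  using mult_add_left[of x "- x" y] mult_add_right[of x y "- y"]
  by (simp_all add: mult_zero eq_neg_iff_add_eq_0 add.commute)

lemma mult_diff: "mult (x - y) z = mult x z - mult y z" "mult x (y - z) = mult x y - mult x z"
  using mult_add_left[of x "- y" z] mult_add_right[of x y "- z"] by (simp_all add: mult_minus)

lemmas mult_expand = mult_add_left mult_add_right mult_diff mult_minus mult_zero

lemma opposite_algebra: "complex_algebra scale (\<lambda>x y. mult y x)"
  by unfold_locales (simp_all add: mult_assoc mult_add_left mult_add_right mult_scale_left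
      mult_scale_right)

end

locale unital_Jordan_derivable = complex_algebra scale mult
  for scale :: "complex \<Rightarrow> 'u::ab_group_add \<Rightarrow> 'u" and mult +
  fixes e :: 'u and m n :: nat and \<delta> :: "'u \<Rightarrow> 'u"
  assumes unit: "mult e x = x" "mult x e = x"
    and weights: "m > 0" "n > 0" "m \<noteq> n"
    and Jordan: "Jordan_derivable_at_zero m n scale mult \<delta>"
    and \<delta>_unit: "\<delta> e = 0"
begin

lemma opposite: "unital_Jordan_derivable scale (\<lambda>x y. mult y x) e n m \<delta>"
proof -
  interpret opp: complex_algebra scale "\<lambda>x y. mult y x" by (rule opposite_algebra)
  show ?thesis
    using Jordan weights
    by unfold_locales
       (auto simp: unit \<delta>_unit Jordan_derivable_at_zero_def add_ac)
qed

lemma \<delta>_additive: "\<delta> (x + y) = \<delta> x + \<delta> y" "\<delta> (x - y) = \<delta> x - \<delta> y" "\<delta> 0 = 0"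
proof -
  interpret additive \<delta> using Jordan by (simp add: Jordan_derivable_at_zero_def)
  show "\<delta> (x + y) = \<delta> x + \<delta> y" "\<delta> (x - y) = \<delta> x - \<delta> y" "\<delta> 0 = 0"
    by (rule add diff zero)+
qed

lemma Jordan_identity:
  assumes "mult s t = 0" and "mult t s = 0"
  shows "scale (of_nat m) (mult (\<delta> s) t + mult (\<delta> t) s) +
    scale (of_nat n) (mult s (\<delta> t) + mult t (\<delta> s)) = 0"
proof -
  have "scale 2 (scale (of_nat m) (mult (\<delta> s) t + mult (\<delta> t) s) +
      scale (of_nat n) (mult s (\<delta> t) + mult t (\<delta> s))) = 0"
    using Jordan assms
    by (simp add: Jordan_derivable_at_zero_def \<delta>_additive scale_right_distrib add_ac)
  then show ?thesis by simp
qed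

text \<open>
  The pair \<open>(p, 1 - p)\<close> gives \<open>(m + n)F = 2mFp + 2npF\<close> for \<open>F = \<delta>(p)\<close>.  Multiplying by \<open>p\<close> on
  both sides leaves \<open>(m + n)pFp = 0\<close>, after which multiplying on one side leaves
  \<open>(m - n)pF = 0\<close> and \<open>(m - n)Fp = 0\<close>; this is where \<open>m \<noteq> n\<close> enters.
\<close>

lemma idempotent_zero:
  assumes p: "mult p p = p"
  shows "\<delta> p = 0"
proof -
  let ?F = "\<delta> p"
  let ?k = "of_nat m :: complex" and ?l = "of_nat n :: complex"
  have kl: "?k + ?l \<noteq> 0" "?k - ?l \<noteq> 0"
    using weights by (simp_all flip: of_nat_add)
  have "scale ?k (mult ?F (e - p) + mult (\<delta> (e - p)) p) +
      scale ?l (mult p (\<delta> (e - p)) + mult (e - p) ?F) = 0"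
    by (rule Jordan_identity) (simp_all add: mult_expand unit p)
  then have R: "scale (?k + ?l) ?F = scale (?k + ?k) (mult ?F p) + scale (?l + ?l) (mult p ?F)"
    unfolding scale_left_distrib
    by (simp add: mult_expand unit \<delta>_additive \<delta>_unit scale_right_distrib
        scale_right_diff_distrib algebra_simps)
  have pp: "mult p (mult p x) = mult p x" for x
    by (simp add: p flip: mult_assoc)
  have L: "scale (?k + ?l) (mult p ?F) =
      scale (?k + ?k) (mult p (mult ?F p)) + scale (?l + ?l) (mult p ?F)"
    using arg_cong[OF R, of "mult p"] by (simp add: mult_expand mult_scale_right pp)
  have R': "scale (?k + ?l) (mult ?F p) =
      scale (?k + ?k) (mult ?F p) + scale (?l + ?l) (mult p (mult ?F p))"
    using arg_cong[OF R, of "\<lambda>y. mult y p"] by (simp add: mult_expand mult_scale_left mult_assoc p)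
  have "scale (?k + ?l) (mult p (mult ?F p)) =
      scale (?k + ?k) (mult p (mult ?F p)) + scale (?l + ?l) (mult p (mult ?F p))"
    using arg_cong[OF R', of "mult p"] by (simp add: mult_expand mult_scale_right pp)
  also have "\<dots> = scale (?k + ?l) (mult p (mult ?F p)) + scale (?k + ?l) (mult p (mult ?F p))"
    unfolding scale_left_distrib by (simp add: add_ac)
  finally have "scale (?k + ?l) (mult p (mult ?F p)) = 0" by simp
  then have pFp: "mult p (mult ?F p) = 0" using kl by simp
  have "scale (?k - ?l) (mult p ?F) = 0"
    using L unfolding scale_left_distrib scale_left_diff_distrib by (simp add: pFp)
  moreover have "scale (?k - ?l) (mult ?F p) = 0"
    using R' unfolding scale_left_distrib scale_left_diff_distrib by (auto simp: pFp)
  ultimately have "mult p ?F = 0" "mult ?F p = 0" using kl by simp_all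
  then show ?thesis using R kl by simp
qed

text \<open>
  Multiplying \<open>m\<delta>(s)t + nt\<delta>(s) = 0\<close> by \<open>t\<close> on both sides kills \<open>t\<delta>(s)t\<close>, and then
  multiplying it on one side separates the two summands.
\<close>

lemma annihilator_invariant:
  assumes t: "mult t t = t" and st: "mult s t = 0" "mult t s = 0"
  shows "mult (\<delta> s) t = 0" and "mult t (\<delta> s) = 0"
proof -
  let ?F = "\<delta> s"
  let ?k = "of_nat m :: complex" and ?l = "of_nat n :: complex"
  have tt: "mult t (mult t x) = mult t x" for x
    by (simp add: t flip: mult_assoc)
  have R: "scale ?k (mult ?F t) + scale ?l (mult t ?F) = 0"
    using Jordan_identity[OF st] by (simp add: idempotent_zero[OF t] mult_zero)
  have L: "scale ?k (mult t (mult ?F t)) + scale ?l (mult t ?F) = 0"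
    using arg_cong[OF R, of "mult t"] by (simp add: mult_expand mult_scale_right tt)
  have "scale (?k + ?l) (mult t (mult ?F t)) = 0"
    using arg_cong[OF L, of "\<lambda>y. mult y t"]
    by (simp add: mult_expand mult_scale_left mult_assoc t scale_left_distrib)
  moreover have "?k + ?l \<noteq> 0"
    using weights by (simp flip: of_nat_add)
  ultimately have "mult t (mult ?F t) = 0" by simp
  with L weights show "mult t ?F = 0" by simp
  with R weights show "mult ?F t = 0" by simp
qed

lemma off_diagonal_zero:
  assumes p: "mult p p = p" and x: "mult p x = x" "mult x p = 0"
  shows "\<delta> x = 0"
proof -
  have "mult x x = 0"
    using mult_assoc[of x p x] by (simp add: x mult_zero)
  then have "\<delta> (p + x) = 0"
    by (intro idempotent_zero) (simp add: mult_expand p x)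
  then show ?thesis by (simp add: \<delta>_additive idempotent_zero[OF p])
qed

text \<open>
  Conjugation by the unipotent element \<open>1 - x\<close> turns \<open>p\<close> into the idempotent \<open>p + x\<close> and
  \<open>a\<close> into \<open>s = a + ax\<close>, so \<open>s\<close> and the idempotent \<open>t = 1 - p - x\<close> annihilate each other.
  Since \<open>\<delta>(s) = \<delta>(a)\<close>, comparing \<open>\<delta>(s)t = 0\<close> with \<open>\<delta>(a)(1 - p) = 0\<close> leaves \<open>\<delta>(a)x = 0\<close>.
\<close>

lemma corner_times_off_diagonal:
  assumes p: "mult p p = p" and a: "mult p a = a" "mult a p = a"
    and x: "mult p x = x" "mult x p = 0"
  shows "mult (\<delta> a) x = 0"
proof -
  have xx: "mult x x = 0" and xa: "mult x a = 0"
    using mult_assoc[of x p x] mult_assoc[of x p a] by (simp_all add: x a mult_zero)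
  have pax: "mult p (mult a x) = mult a x" and axp: "mult (mult a x) p = 0"
    using mult_assoc[of p a x] mult_assoc[of a x p] by (simp_all add: x a mult_zero)
  have xax: "mult x (mult a x) = 0" and axx: "mult (mult a x) x = 0"
    using mult_assoc[of x a x] mult_assoc[of a x x] by (simp_all add: xa xx mult_zero)
  have "mult (\<delta> (a + mult a x)) (e - p - x) = 0"
    by (rule annihilator_invariant) (simp_all add: mult_expand unit p a x xx xa pax axp xax axx)
  moreover have "\<delta> (mult a x) = 0"
    using p pax axp by (rule off_diagonal_zero)
  moreover have "mult (\<delta> a) (e - p) = 0"
    by (rule annihilator_invariant) (simp_all add: mult_expand unit p a)
  ultimately show ?thesis
    by (simp add: \<delta>_additive mult_expand)
qed

lemmas off_diagonal_times_corner =
  unital_Jordan_derivable.corner_times_off_diagonal[OF opposite]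

end


section \<open>Generalized matrix algebras\<close>

context Morita_context
begin

lemma zero_products:
  "\<phi> (MN.tensor 0 y) = 0" "\<phi> (MN.tensor x 0) = 0"
  "\<psi> (NM.tensor 0 x) = 0" "\<psi> (NM.tensor y 0) = 0"
  "lM a 0 = 0" "lM 0 x = 0" "rM 0 b = 0" "rM x 0 = 0"
  "lN b 0 = 0" "lN 0 y = 0" "rN 0 a = 0" "rN y 0 = 0"
  using mult_simps(1)[of 0 0 y] mult_simps(2)[of x 0 0] mult_simps(7)[of 0 0 x]
    mult_simps(8)[of y 0 0] M.act_simps(1)[of 0 0 x] M.act_simps(2)[of a 0 0]
    M.act_simps(5)[of x 0 0] M.act_simps(6)[of 0 0 b] N.act_simps(1)[of 0 0 y]
    N.act_simps(2)[of b 0 0] N.act_simps(5)[of y 0 0] N.act_simps(6)[of 0 0 a]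
  by simp_all

lemma gm_mult_entries:
  "gm_mult ((a, x), (y, b)) ((a', x'), (y', b')) =
     ((a * a' + \<phi> (MN.tensor x y'), lM a x' + rM x b'),
      (rN y a' + lN b y', \<psi> (NM.tensor y x') + b * b'))"
  by (simp add: gm_mult_def)

lemmas gm_simps = gm_mult_entries zero_products M.lact_one M.ract_one N.lact_one N.ract_one
  zero_prod_def

text \<open>
  The two diagonal corners belong to the idempotents \<open>?P\<close> and \<open>?Q\<close> below; \<open>\<M>\<close> and \<open>\<N>\<close> are
  the off-diagonal spaces of both, with their roles exchanged, so each of the general results
  is applied once with \<open>?P\<close> and once with \<open>?Q\<close>.
\<close>

lemma Jordan_derivable_corners:
  assumes "m > 0" "n > 0" "m \<noteq> n" "Jordan_derivable_at_zero m n gm_scale gm_mult \<delta>"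
    and "\<delta> ((1, 0), (0, 1)) = 0"
  shows "\<delta> ((0, x), (0, 0)) = 0" and "\<delta> ((0, 0), (y, 0)) = 0"
    and "\<exists>a'. \<delta> ((a, 0), (0, 0)) = ((a', 0), (0, 0)) \<and> (\<forall>x. lM a' x = 0) \<and> (\<forall>y. rN y a' = 0)"
    and "\<exists>b'. \<delta> ((0, 0), (0, b)) = ((0, 0), (0, b')) \<and> (\<forall>y. lN b' y = 0) \<and> (\<forall>x. rM x b' = 0)"
proof -
  interpret U: unital_Jordan_derivable gm_scale gm_mult "((1, 0), (0, 1))" m n \<delta>
    using assms gm_mult_unit gen_matrix_algebra
    by (simp add: unital_Jordan_derivable_def unital_Jordan_derivable_axioms_def)
  let ?P = "((1, 0), (0, 0)) :: ('a, 'm, 'n, 'b) gen_matrix"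
    and ?Q = "((0, 0), (0, 1)) :: ('a, 'm, 'n, 'b) gen_matrix"
  have P: "gm_mult ?P ?P = ?P" and Q: "gm_mult ?Q ?Q = ?Q"
    by (simp_all add: gm_simps)
  show "\<delta> ((0, x), (0, 0)) = 0"
    by (rule U.off_diagonal_zero[OF P]) (simp_all add: gm_simps)
  show "\<delta> ((0, 0), (y, 0)) = 0"
    by (rule U.off_diagonal_zero[OF Q]) (simp_all add: gm_simps)
  show "\<exists>a'. \<delta> ((a, 0), (0, 0)) = ((a', 0), (0, 0)) \<and> (\<forall>x. lM a' x = 0) \<and> (\<forall>y. rN y a' = 0)"
  proof -
    let ?a = "((a, 0), (0, 0)) :: ('a, 'm, 'n, 'b) gen_matrix"
    obtain a' x' y' b' where F: "\<delta> ?a = ((a', x'), (y', b'))"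
      by (metis surj_pair)
    have "gm_mult (\<delta> ?a) ?Q = 0" "gm_mult ?Q (\<delta> ?a) = 0"
      by (rule U.annihilator_invariant[OF Q]; simp add: gm_simps)+
    then have "x' = 0" "y' = 0" "b' = 0" by (simp_all add: F gm_simps)
    moreover have "gm_mult (\<delta> ?a) ((0, x), (0, 0)) = 0" for x
      by (rule U.corner_times_off_diagonal[OF P]) (simp_all add: gm_simps)
    moreover have "gm_mult ((0, 0), (y, 0)) (\<delta> ?a) = 0" for y
      by (rule U.off_diagonal_times_corner[OF P]) (simp_all add: gm_simps)
    ultimately show ?thesis by (simp add: F gm_simps)
  qed
  show "\<exists>b'. \<delta> ((0, 0), (0, b)) = ((0, 0), (0, b')) \<and> (\<forall>y. lN b' y = 0) \<and> (\<forall>x. rM x b' = 0)"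
  proof -
    let ?b = "((0, 0), (0, b)) :: ('a, 'm, 'n, 'b) gen_matrix"
    obtain a' x' y' b' where F: "\<delta> ?b = ((a', x'), (y', b'))"
      by (metis surj_pair)
    have "gm_mult (\<delta> ?b) ?P = 0" "gm_mult ?P (\<delta> ?b) = 0"
      by (rule U.annihilator_invariant[OF P]; simp add: gm_simps)+
    then have "a' = 0" "x' = 0" "y' = 0" by (simp_all add: F gm_simps)
    moreover have "gm_mult (\<delta> ?b) ((0, 0), (y, 0)) = 0" for y
      by (rule U.corner_times_off_diagonal[OF Q]) (simp_all add: gm_simps)
    moreover have "gm_mult ((0, x), (0, 0)) (\<delta> ?b) = 0" for x
      by (rule U.off_diagonal_times_corner[OF Q]) (simp_all add: gm_simps)
    ultimately show ?thesis by (simp add: F gm_simps)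
  qed
qed

end


theorem theorem4p1:
  fixes scaleA :: "complex \<Rightarrow> 'a::{ring,monoid_mult} \<Rightarrow> 'a"
    and scaleB :: "complex \<Rightarrow> 'b::{ring,monoid_mult} \<Rightarrow> 'b"
    and scaleM :: "complex \<Rightarrow> 'm::ab_group_add \<Rightarrow> 'm"
    and scaleN :: "complex \<Rightarrow> 'n::ab_group_add \<Rightarrow> 'n"
    and lM :: "'a \<Rightarrow> 'm \<Rightarrow> 'm" and rM :: "'m \<Rightarrow> 'b \<Rightarrow> 'm"
    and lN :: "'b \<Rightarrow> 'n \<Rightarrow> 'n" and rN :: "'n \<Rightarrow> 'a \<Rightarrow> 'n"
    and \<phi> :: "('m \<times> 'n \<Rightarrow>\<^sub>0 complex) set \<Rightarrow> 'a"
    and \<psi> :: "('n \<times> 'm \<Rightarrow>\<^sub>0 complex) set \<Rightarrow> 'b"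
    and m n :: nat
    and \<delta> :: "('a, 'm, 'n, 'b) gen_matrix \<Rightarrow> ('a, 'm, 'n, 'b) gen_matrix"
  assumes "Morita_context scaleA scaleB scaleM scaleN lM rM lN rN \<phi> \<psi>"
    and "m > 0" and "n > 0" and "m \<noteq> n"
    and "(left_faithful lM \<and> right_faithful rM) \<or>
         (left_faithful lN \<and> right_faithful rN) \<or>
         (left_faithful lM \<and> left_faithful lN) \<or>
         (right_faithful rN \<and> right_faithful rM)"
    and "Jordan_derivable_at_zero m n
           (Morita_context.gm_scale scaleA scaleB scaleM scaleN)
           (Morita_context.gm_mult scaleM scaleN lM rM lN rN \<phi> \<psi>) \<delta>"
    and "\<delta> ((1, 0), (0, 1)) = ((0, 0), (0, 0))"
  shows "\<forall>X. \<delta> X = ((0, 0), (0, 0))"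
proof
  fix X :: "('a, 'm, 'n, 'b) gen_matrix"
  interpret Morita_context scaleA scaleB scaleM scaleN lM rM lN rN \<phi> \<psi> by (rule assms(1))
  have unit: "\<delta> ((1, 0), (0, 1)) = 0" using assms(7) by (simp add: zero_prod_def)
  note corners = Jordan_derivable_corners[OF assms(2-4,6) unit]
  obtain a x y b where X: "X = ((a, x), (y, b))"
    by (metis surj_pair)
  obtain a' where a': "\<delta> ((a, 0), (0, 0)) = ((a', 0), (0, 0))" "\<forall>x. lM a' x = 0" "\<forall>y. rN y a' = 0"
    using corners(3) by blast
  obtain b' where b': "\<delta> ((0, 0), (0, b)) = ((0, 0), (0, b'))" "\<forall>y. lN b' y = 0" "\<forall>x. rM x b' = 0"
    using corners(4) by blast
  have zero: "a' = 0" "b' = 0"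
    using assms(5) a' b' unfolding left_faithful_def right_faithful_def by blast+
  interpret \<delta>: additive \<delta> using assms(6) by (simp add: Jordan_derivable_at_zero_def)
  have "X = ((a, 0), (0, 0)) + ((0, x), (0, 0)) + ((0, 0), (y, 0)) + ((0, 0), (0, b))"
    by (simp add: X)
  then have "\<delta> X = \<delta> ((a, 0), (0, 0)) + \<delta> ((0, x), (0, 0)) + \<delta> ((0, 0), (y, 0)) +
      \<delta> ((0, 0), (0, b))"
    by (simp only: \<delta>.add)
  then show "\<delta> X = ((0, 0), (0, 0))"
    by (simp add: corners(1,2) a' b' zero zero_prod_def)
qed

end
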